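(* Let $f\in C(I,I)$. The following are equivalent: (1) $f$ is strongly mixing; (2) $\mathcal C(\mathcal U)>2$ for every open cover $\mathcal U$ of $I$ consisting of two non-dense open sets; (3) $f$ has uniformly positive entropy; (4) $f$ is topological K.
   Context: $I=[0,1]$, $C(I,I)$ continuous self-maps of $I$. $f$ is strongly mixing if for all nonempty open $U,V\subset I$ there is $N$ with $f^nU\cap V\ne\emptyset$ for all $n\ge N$. For a finite open cover $\mathcal U$, $N(\mathcal U)$ is the minimal cardinality of a subcover, $\mathcal U\vee\mathcal V=\{U\cap V\}$, and $\mathcal C(\mathcal U)=\lim_{n\to\infty}N(\bigvee_{i=0}^{n-1}f^{-i}\mathcal U)$. For $A_1,\dots,A_k\subset I$, $J\subset\mathbb Z_+$ is an independence set if $\bigcap_{i\in F}f^{-i}A_{s(i)}\ne\emptyset$ for all nonempty finite $F\subset J$ and $s\in\{1,\dots,k\}^F$. A tuple $\langle x_1,\dots,x_k\rangle$ is an IE-tuple if for all neighborhoods $U_j\ni x_j$, $(U_1,\dots,U_k)$ has an independence set of positive density. $f$ has uniformly positive entropy if every pair $\langle x_1,x_2\rangle$ with $x_1\ne x_2$ is an IE-tuple, and is topological K if for every $k\ge2$ every $k$-tuple with pairwise distinct entries is an IE-tuple. *)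

theory Defs
  imports "HOL-Analysis.Analysis"
begin

definition unitI :: "real set" where "unitI = {0..1}"

definition interval_map :: "(real \<Rightarrow> real) \<Rightarrow> bool" where
  "interval_map f \<longleftrightarrow> continuous_on unitI f \<and> f ` unitI \<subseteq> unitI"

definition openI :: "real set \<Rightarrow> bool" where
  "openI U \<longleftrightarrow> openin (top_of_set unitI) U"

definition strongly_mixing :: "(real \<Rightarrow> real) \<Rightarrow> bool" where
  "strongly_mixing f \<longleftrightarrow>
     (\<forall>U V. openI U \<and> U \<noteq> {} \<and> openI V \<and> V \<noteq> {} \<longrightarrow>
        (\<exists>N. \<forall>n\<ge>N. (f ^^ n) ` U \<inter> V \<noteq> {}))"

definition preI :: "(real \<Rightarrow> real) \<Rightarrow> nat \<Rightarrow> real set \<Rightarrow> real set" where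
  "preI f i A = {x \<in> unitI. (f ^^ i) x \<in> A}"

definition open_coverI :: "real set set \<Rightarrow> bool" where
  "open_coverI \<U> \<longleftrightarrow> finite \<U> \<and> (\<forall>U\<in>\<U>. openI U) \<and> \<Union>\<U> = unitI"

definition min_subcover :: "real set set \<Rightarrow> nat" where
  "min_subcover \<U> = (LEAST m. \<exists>\<V>\<subseteq>\<U>. \<Union>\<V> = unitI \<and> card \<V> = m \<and> finite \<V>)"

definition join_cover :: "(real \<Rightarrow> real) \<Rightarrow> real set set \<Rightarrow> nat \<Rightarrow> real set set" where
  "join_cover f \<U> n =
     {unitI \<inter> (\<Inter>i\<in>{..<n}. preI f i (s i)) | s. \<forall>i<n. s i \<in> \<U>}"

definition complexity :: "(real \<Rightarrow> real) \<Rightarrow> real set set \<Rightarrow> enat" where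
  "complexity f \<U> = lim (\<lambda>n. enat (min_subcover (join_cover f \<U> n)))"

definition independence_set ::
  "(real \<Rightarrow> real) \<Rightarrow> nat \<Rightarrow> (nat \<Rightarrow> real set) \<Rightarrow> nat set \<Rightarrow> bool" where
  "independence_set f k A J \<longleftrightarrow>
     (\<forall>F s. finite F \<and> F \<noteq> {} \<and> F \<subseteq> J \<and> (\<forall>i\<in>F. s i \<in> {1..k}) \<longrightarrow>
        (\<Inter>i\<in>F. preI f i (A (s i))) \<noteq> {})"

definition positive_density :: "nat set \<Rightarrow> bool" where
  "positive_density J \<longleftrightarrow>
     (\<exists>d>0. (\<lambda>n. real (card (J \<inter> {..<n})) / real n) \<longlonglongrightarrow> d)"

definition neighborhoodI :: "real \<Rightarrow> real set \<Rightarrow> bool" where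
  "neighborhoodI x N \<longleftrightarrow> N \<subseteq> unitI \<and> (\<exists>W. openI W \<and> x \<in> W \<and> W \<subseteq> N)"

definition IE_tuple :: "(real \<Rightarrow> real) \<Rightarrow> nat \<Rightarrow> (nat \<Rightarrow> real) \<Rightarrow> bool" where
  "IE_tuple f k x \<longleftrightarrow>
     (\<forall>U. (\<forall>j\<in>{1..k}. neighborhoodI (x j) (U j)) \<longrightarrow>
        (\<exists>J. independence_set f k U J \<and> positive_density J))"

definition uniformly_positive_entropy :: "(real \<Rightarrow> real) \<Rightarrow> bool" where
  "uniformly_positive_entropy f \<longleftrightarrow>
     (\<forall>x1\<in>unitI. \<forall>x2\<in>unitI. x1 \<noteq> x2 \<longrightarrow> IE_tuple f 2 (\<lambda>j. if j = 1 then x1 else x2))"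

definition topological_K :: "(real \<Rightarrow> real) \<Rightarrow> bool" where
  "topological_K f \<longleftrightarrow>
     (\<forall>k\<ge>2. \<forall>x. (\<forall>j\<in>{1..k}. x j \<in> unitI) \<and>
        (\<forall>i\<in>{1..k}. \<forall>j\<in>{1..k}. i \<noteq> j \<longrightarrow> x i \<noteq> x j) \<longrightarrow> IE_tuple f k x)"

end

theory Submission
  imports Defs
begin

text \<open>A mixing interval map satisfies \<open>f\<^sup>N K \<supseteq> K'\<close> for all large \<open>N\<close> and all compact intervals
  \<open>K, K'\<close> in the interior, so the multiples of \<open>N\<close> are an independence set: this gives topological K.
  For a cover by two non-dense sets, an independence set with two elements for the exteriors
  yields three points no two of which lie in a common element of the join, so uniformly positive
  entropy forces complexity at least 3.

  Conversely, a cover by the complements of two disjoint intervals \<open>B\<^sub>1, B\<^sub>2\<close> has complexity at most 2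
  as soon as every orbit avoids \<open>B\<close> along one of two prescribed index sequences. Constant sequences show
  that \<open>f\<close> is transitive; alternating ones show that \<open>f\<close> does not interchange \<open>[0,z]\<close> and \<open>[z,1]\<close>.
  A transitive map has an interior fixed point \<open>z\<close>; if the two sides of \<open>z\<close> are not interchanged,
  some one-sided neighbourhood of \<open>z\<close> covers itself after \<open>j\<close> and after \<open>j + 1\<close> steps, hence
  eventually covers every compact interval in the interior, and every interval reaches it.\<close>

section \<open>Relatively open sets, iterates and images of intervals\<close>

lemma openI_contains_interval:
  assumes "openI U" "U \<noteq> {}"
  obtains p q where "0 < p" "p < q" "q < 1" "{p..q} \<subseteq> U"
proof -
  obtain T where T: "open T" "U = {0..1} \<inter> T"
    using assms(1) unfolding openI_def unitI_def openin_open by auto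
  \<comment> \<open>An open set that meets the closure of \<open>{0<..<1}\<close>, which is all of
    the unit interval, meets \<open>{0<..<1}\<close> itself; this keeps the interval away from the
    end points.\<close>
  have "T \<inter> closure {0<..<1::real} \<noteq> {}" using T assms(2) by auto
  then have "T \<inter> {0<..<1} \<noteq> {}"
    using open_Int_closure_eq_empty[OF T(1)] by blast
  then obtain y where y: "y \<in> T \<inter> {0<..<1}" by blast
  have "open (T \<inter> {0<..<1})" using T by auto
  then obtain e where e: "e > 0" "cball y e \<subseteq> T \<inter> {0<..<1}"
    using y open_contains_cball by blast
  have *: "{y - e..y + e} \<subseteq> T \<inter> {0<..<1}"
    using e(2) by (simp add: cball_eq_atLeastAtMost)
  have "y - e \<in> {y - e..y + e}" "y + e \<in> {y - e..y + e}" using e by auto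
  then have "y - e \<in> {0<..<1}" "y + e \<in> {0<..<1}" using * by blast+
  moreover have "{y - e..y + e} \<subseteq> U" using * T by (auto simp: subset_iff)
  ultimately show ?thesis using that[of "y - e" "y + e"] e by auto
qed

lemma openI_subset: "openI U \<Longrightarrow> U \<subseteq> unitI"
  unfolding openI_def by (metis openin_imp_subset)

lemma openI_inter_open: "open T \<Longrightarrow> openI (unitI \<inter> T)"
  unfolding openI_def by auto

lemma openI_minus_interval: "openI (unitI - {p..q})"
  using openI_inter_open[of "- {p..q}"] by (simp add: Diff_eq open_Compl)

lemma interval_map_funpow:
  assumes "interval_map f"
  shows "interval_map (f ^^ n)"
proof (induction n)
  case 0
  then show ?case by (simp add: interval_map_def)
next
  case (Suc n)
  then show ?case using assms unfolding interval_map_def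
    by (auto intro!: continuous_on_compose2[of unitI f unitI "f ^^ n"])
qed

lemma funpow_in_unitI: "interval_map f \<Longrightarrow> x \<in> unitI \<Longrightarrow> (f ^^ n) x \<in> unitI"
  using interval_map_funpow[of f n] unfolding interval_map_def by auto

lemma openI_preI:
  assumes "interval_map f" "openI V"
  shows "openI (preI f n V)"
proof -
  have "preI f n V = unitI \<inter> (f ^^ n) -` V" unfolding preI_def by auto
  moreover have "openin (top_of_set unitI) (unitI \<inter> (f ^^ n) -` V)"
    using interval_map_funpow[OF assms(1), of n] assms(2)
    unfolding interval_map_def openI_def
    by (meson continuous_openin_preimage image_subset_iff_funcset)
  ultimately show ?thesis by (simp add: openI_def)
qed

lemma openI_Int: "openI U \<Longrightarrow> openI V \<Longrightarrow> openI (U \<inter> V)"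
  unfolding openI_def by auto

text \<open>Intermediate value theorem for iterates. The covering relations below start from two
  points exhibited in an image.\<close>

lemma funpow_image_contains_interval:
  assumes "interval_map f" "0 \<le> a" "b \<le> 1"
    and "p \<in> (f ^^ n) ` {a..b}" "q \<in> (f ^^ n) ` {a..b}"
  shows "{p..q} \<subseteq> (f ^^ n) ` {a..b}"
proof -
  have "continuous_on {a..b} (f ^^ n)"
    using interval_map_funpow[OF assms(1), of n] assms(2,3)
    unfolding interval_map_def unitI_def
    by (meson atLeastatMost_subset_iff continuous_on_subset)
  then have "connected ((f ^^ n) ` {a..b})"
    by (intro connected_continuous_image) auto
  then show ?thesis using assms(4,5) connected_contains_Icc by blast
qed

lemma funpow_image_trans:
  assumes "B \<subseteq> (f ^^ m) ` A" "C \<subseteq> (f ^^ n) ` B"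
  shows "C \<subseteq> (f ^^ (m + n)) ` A"
proof -
  have "C \<subseteq> (f ^^ n) ` ((f ^^ m) ` A)" using assms by blast
  then show ?thesis by (simp add: add.commute[of m] funpow_add image_comp)
qed


subsection \<open>Mixing implies topological K\<close>

text \<open>The images of \<open>{u<..<v}\<close> eventually meet both \<open>[0, a)\<close> and
  \<open>(b, 1]\<close>; by connectedness the images of \<open>{u..v}\<close> then contain all that
  lies between.\<close>

lemma strongly_mixing_eventually_covers:
  assumes f: "interval_map f" and mix: "strongly_mixing f"
    and "0 \<le> u" "u < v" "v \<le> 1" "0 < a" "a < b" "b < 1"
  shows "\<exists>N. \<forall>n\<ge>N. {a..b} \<subseteq> (f ^^ n) ` {u..v}"
proof -
  have o: "openI {u<..<v}" "openI (unitI \<inter> {..<a})" "openI (unitI \<inter> {b<..})"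
    using openI_inter_open[of "{u<..<v}"] openI_inter_open[of "{..<a}"]
      openI_inter_open[of "{b<..}"] assms
    by (auto simp: unitI_def Int_absorb1 subset_iff)
  have ne: "{u<..<v} \<noteq> {}" using assms by auto
  have "0 \<in> unitI \<inter> {..<a}" "1 \<in> unitI \<inter> {b<..}" using assms by (auto simp: unitI_def)
  then have ne0: "unitI \<inter> {..<a} \<noteq> {}" and ne1: "unitI \<inter> {b<..} \<noteq> {}" by blast+
  obtain N0 where N0: "\<And>n. n \<ge> N0 \<Longrightarrow> (f ^^ n) ` {u<..<v} \<inter> (unitI \<inter> {..<a}) \<noteq> {}"
    using mix o ne ne0 unfolding strongly_mixing_def by meson
  obtain N1 where N1: "\<And>n. n \<ge> N1 \<Longrightarrow> (f ^^ n) ` {u<..<v} \<inter> (unitI \<inter> {b<..}) \<noteq> {}"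
    using mix o ne ne1 unfolding strongly_mixing_def by meson
  show ?thesis
  proof (intro exI allI impI)
    fix n assume n: "max N0 N1 \<le> n"
    obtain x where x: "x \<in> {u<..<v}" "(f ^^ n) x < a" using N0[of n] n by force
    obtain y where y: "y \<in> {u<..<v}" "b < (f ^^ n) y" using N1[of n] n by force
    have "{(f ^^ n) x..(f ^^ n) y} \<subseteq> (f ^^ n) ` {u..v}"
      using f x y assms by (intro funpow_image_contains_interval) auto
    moreover have "{a..b} \<subseteq> {(f ^^ n) x..(f ^^ n) y}" using x y by auto
    ultimately show "{a..b} \<subseteq> (f ^^ n) ` {u..v}" by blast
  qed
qed

text \<open>A point following the shifted itinerary \<open>s 1, s 2, ...\<close> lies in
  \<open>K (s 1)\<close>, so it has a preimage under \<open>f ^^ N\<close> in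
  \<open>K (s 0)\<close>. Finite itineraries suffice because independence is tested on finite
  sets.\<close>

lemma itinerary_realized:
  fixes K :: "nat \<Rightarrow> real set"
  assumes "\<And>i j. i \<in> A \<Longrightarrow> j \<in> A \<Longrightarrow> K j \<subseteq> (f ^^ N) ` K i"
    and "\<And>i. i \<in> A \<Longrightarrow> K i \<noteq> {}"
    and "\<And>m. s m \<in> A"
  shows "\<exists>x\<in>K (s 0). \<forall>m\<le>M. (f ^^ (m * N)) x \<in> K (s m)"
  using assms(3)
proof (induction M arbitrary: s)
  case 0
  then show ?case using assms(2) by fastforce
next
  case (Suc M)
  obtain y where y: "y \<in> K (s 1)" "\<And>m. m \<le> M \<Longrightarrow> (f ^^ (m * N)) y \<in> K (s (Suc m))"
    using Suc.IH[of "\<lambda>m. s (Suc m)"] Suc.prems by auto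
  obtain x where x: "x \<in> K (s 0)" "y = (f ^^ N) x"
    using assms(1)[of "s 0" "s 1"] Suc.prems y(1) by blast
  have "(f ^^ (m * N)) x \<in> K (s m)" if "m \<le> Suc M" for m
  proof (cases m)
    case 0
    then show ?thesis using x by simp
  next
    case (Suc l)
    then show ?thesis using y(2)[of l] that x(2)
      by (simp add: funpow_add add.commute[of N])
  qed
  then show ?case using x by blast
qed

lemma positive_density_multiples:
  assumes "N > 0"
  shows "positive_density (range (\<lambda>m. m * N))"
proof -
  define J where "J = range (\<lambda>m. m * N)"
  \<comment> \<open>This is the ceiling of \<open>n / N\<close>, since \<open>0\<close> counts as a
    multiple. Division by \<open>n\<close> then squeezes the ratio towards
    \<open>1 / N\<close>.\<close>
  have card: "card (J \<inter> {..<n}) = (n + N - 1) div N" for n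
  proof -
    have "m * N < n \<longleftrightarrow> m < (n + N - 1) div N" for m
    proof -
      have "m < (n + N - 1) div N \<longleftrightarrow> Suc m * N \<le> n + N - 1"
        using assms by (metis Suc_le_eq less_eq_div_iff_mult_less_eq)
      also have "\<dots> \<longleftrightarrow> m * N < n" using assms by auto
      finally show ?thesis by simp
    qed
    then have "J \<inter> {..<n} = (\<lambda>m. m * N) ` {..<(n + N - 1) div N}" unfolding J_def by auto
    moreover have "inj (\<lambda>m. m * N)" using assms by (auto intro!: injI)
    ultimately show ?thesis by (simp add: card_image inj_on_subset)
  qed
  have lo: "1 / real N \<le> real (card (J \<inter> {..<n})) / real n" if "n > 0" for n
  proof -
    have "n \<le> ((n + N - 1) div N) * N"
      using assms div_mult_mod_eq[of "n + N - 1" N] mod_less_divisor[of N "n + N - 1"] by linarith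
    then have "real n \<le> real (card (J \<inter> {..<n})) * real N"
      unfolding card by (metis of_nat_le_iff of_nat_mult)
    then show ?thesis using that assms by (simp add: field_simps)
  qed
  have hi: "real (card (J \<inter> {..<n})) / real n \<le> 1 / real N + 1 / real n" if "n > 0" for n
  proof -
    have "((n + N - 1) div N) * N \<le> n + N" using assms
      by (metis div_times_less_eq_dividend diff_le_self order_trans)
    then have "real (card (J \<inter> {..<n})) * real N \<le> real n + real N"
      unfolding card by (metis of_nat_le_iff of_nat_mult of_nat_add)
    then show ?thesis using that assms by (simp add: field_simps)
  qed
  have "(\<lambda>n. 1 / real N + 1 / real n) \<longlonglongrightarrow> 1 / real N + 0"
    by (intro tendsto_intros lim_1_over_n)
  then have up: "(\<lambda>n. 1 / real N + 1 / real n) \<longlonglongrightarrow> 1 / real N" by simp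
  have "(\<lambda>n. real (card (J \<inter> {..<n})) / real n) \<longlonglongrightarrow> 1 / real N"
  proof (rule tendsto_sandwich[OF _ _ tendsto_const up])
    show "\<forall>\<^sub>F n in sequentially. 1 / real N \<le> real (card (J \<inter> {..<n})) / real n"
      using lo by (intro eventually_sequentiallyI[of 1]) simp
    show "\<forall>\<^sub>F n in sequentially. real (card (J \<inter> {..<n})) / real n \<le> 1 / real N + 1 / real n"
      using hi by (intro eventually_sequentiallyI[of 1]) simp
  qed
  then show ?thesis unfolding positive_density_def J_def[symmetric]
    using assms by (intro exI[of _ "1 / real N"]) auto
qed

lemma strongly_mixing_imp_topological_K:
  assumes f: "interval_map f" and mix: "strongly_mixing f"
  shows "topological_K f"
  unfolding topological_K_def IE_tuple_def
proof (intro allI impI)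
  fix k :: nat and x :: "nat \<Rightarrow> real" and U :: "nat \<Rightarrow> real set"
  assume "2 \<le> k" and U: "\<forall>j\<in>{1..k}. neighborhoodI (x j) (U j)"
  have "\<exists>p q. 0 < p \<and> p < q \<and> q < 1 \<and> {p..q} \<subseteq> U j" if j: "j \<in> {1..k}" for j
  proof -
    obtain W where "openI W" "W \<noteq> {}" "W \<subseteq> U j"
      using U j unfolding neighborhoodI_def by blast
    then show ?thesis using openI_contains_interval[of W] by (metis subset_trans)
  qed
  then obtain p q where pq: "\<And>j. j \<in> {1..k} \<Longrightarrow> 0 < p j \<and> p j < q j \<and> q j < 1 \<and> {p j..q j} \<subseteq> U j"
    by metis
  define K where "K = (\<lambda>j. {p j..q j})"
  have "\<exists>N. \<forall>n\<ge>N. K j \<subseteq> (f ^^ n) ` K i" if "i \<in> {1..k}" "j \<in> {1..k}" for i j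
    unfolding K_def using pq[OF that(1)] pq[OF that(2)]
    by (intro strongly_mixing_eventually_covers[OF f mix]) auto
  then obtain N where N: "\<And>i j n. i \<in> {1..k} \<Longrightarrow> j \<in> {1..k} \<Longrightarrow> n \<ge> N i j \<Longrightarrow> K j \<subseteq> (f ^^ n) ` K i"
    by metis
  \<comment> \<open>The sum dominates the finitely many thresholds \<open>N i j\<close>;
    \<open>Suc\<close> makes \<open>M\<close> positive, so that its multiples have positive
    density.\<close>
  define M where "M = Suc (\<Sum>i\<in>{1..k}. \<Sum>j\<in>{1..k}. N i j)"
  have "N i j \<le> M" if "i \<in> {1..k}" "j \<in> {1..k}" for i j
  proof -
    have "N i j \<le> (\<Sum>j\<in>{1..k}. N i j)" using that by (intro member_le_sum) auto
    also have "\<dots> \<le> (\<Sum>i\<in>{1..k}. \<Sum>j\<in>{1..k}. N i j)"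
      using that by (intro member_le_sum[where f="\<lambda>i. \<Sum>j\<in>{1..k}. N i j"]) auto
    finally show ?thesis unfolding M_def by simp
  qed
  then have M: "\<And>i j. i \<in> {1..k} \<Longrightarrow> j \<in> {1..k} \<Longrightarrow> K j \<subseteq> (f ^^ M) ` K i"
    using N by blast
  have Kne: "K i \<noteq> {}" if "i \<in> {1..k}" for i using pq[OF that] unfolding K_def by auto
  have Kunit: "K i \<subseteq> unitI \<and> K i \<subseteq> U i" if "i \<in> {1..k}" for i
    using pq[OF that] unfolding K_def unitI_def by (auto simp: subset_iff)
  have "M > 0" unfolding M_def by simp
  have "independence_set f k U (range (\<lambda>m. m * M))"
    unfolding independence_set_def
  proof (intro allI impI, elim conjE)
    fix F :: "nat set" and s :: "nat \<Rightarrow> nat"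
    assume F: "finite F" "F \<noteq> {}" "F \<subseteq> range (\<lambda>m. m * M)" "\<forall>i\<in>F. s i \<in> {1..k}"
    \<comment> \<open>Multiples of \<open>M\<close> outside \<open>F\<close> are unconstrained; the
      default \<open>1\<close> is a legal index because \<open>2 \<le> k\<close>.\<close>
    define t where "t = (\<lambda>m. if m * M \<in> F then s (m * M) else 1)"
    have t: "t m \<in> {1..k}" for m using F(4) \<open>2 \<le> k\<close> unfolding t_def by auto
    obtain y where y: "y \<in> K (t 0)" "\<forall>m\<le>Max F. (f ^^ (m * M)) y \<in> K (t m)"
      using itinerary_realized[where A="{1..k}" and K=K and f=f and N=M and s=t and M="Max F"] M Kne t by blast
    have "y \<in> preI f i (U (s i))" if i: "i \<in> F" for i
    proof -
      obtain m where m: "i = m * M" using F(3) i by auto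
      have "m \<le> m * M" using \<open>M > 0\<close> by simp
      then have "m \<le> Max F" using Max_ge[OF F(1) i] m by linarith
      then have "(f ^^ i) y \<in> K (s i)" using y(2) m i unfolding t_def by auto
      then show ?thesis using Kunit[of "s i"] Kunit[OF t[of 0]] F(4) i y(1)
        unfolding preI_def by auto
    qed
    then show "(\<Inter>i\<in>F. preI f i (U (s i))) \<noteq> {}" by blast
  qed
  then show "\<exists>J. independence_set f k U J \<and> positive_density J"
    using positive_density_multiples[OF \<open>M > 0\<close>] by blast
qed

lemma topological_K_imp_upe:
  assumes "topological_K f"
  shows "uniformly_positive_entropy f"
  unfolding uniformly_positive_entropy_def
proof (intro ballI impI)
  fix x1 x2 assume "x1 \<in> unitI" "x2 \<in> unitI" "x1 \<noteq> (x2::real)"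
  then show "IE_tuple f 2 (\<lambda>j. if j = 1 then x1 else x2)"
    by (intro assms[unfolded topological_K_def, THEN spec, THEN mp, THEN spec, THEN mp]) auto
qed

subsection \<open>Complexity of two-set covers\<close>

lemma join_cover_mem_iff:
  "E \<in> join_cover f \<U> n \<longleftrightarrow>
     (\<exists>s. (\<forall>i<n. s i \<in> \<U>) \<and> E = {x \<in> unitI. \<forall>i<n. (f ^^ i) x \<in> s i})"
proof -
  have "unitI \<inter> (\<Inter>i\<in>{..<n}. preI f i (s i)) = {x \<in> unitI. \<forall>i<n. (f ^^ i) x \<in> s i}" for s
    unfolding preI_def by auto
  then show ?thesis unfolding join_cover_def by auto
qed

lemma join_coverI:
  "(\<And>i. i < n \<Longrightarrow> s i \<in> \<U>) \<Longrightarrow> {x \<in> unitI. \<forall>i<n. (f ^^ i) x \<in> s i} \<in> join_cover f \<U> n"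
  unfolding join_cover_mem_iff by (intro exI[of _ s]) simp

lemma finite_join_cover:
  assumes "finite \<U>"
  shows "finite (join_cover f \<U> n)"
proof -
  have "join_cover f \<U> n \<subseteq>
      (\<lambda>s. {x \<in> unitI. \<forall>i<n. (f ^^ i) x \<in> s i}) ` (PiE {..<n} (\<lambda>_. \<U>))"
  proof
    fix E assume "E \<in> join_cover f \<U> n"
    then obtain s where s: "\<forall>i<n. s i \<in> \<U>" "E = {x \<in> unitI. \<forall>i<n. (f ^^ i) x \<in> s i}"
      unfolding join_cover_mem_iff by blast
    \<comment> \<open>Only the values of \<open>s\<close> below \<open>n\<close> matter, so its
      restriction yields the same set and lies in a finite function space.\<close>
    show "E \<in> (\<lambda>s. {x \<in> unitI. \<forall>i<n. (f ^^ i) x \<in> s i}) ` (PiE {..<n} (\<lambda>_. \<U>))"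
      using s by (intro image_eqI[of _ _ "restrict s {..<n}"]) auto
  qed
  then show ?thesis using assms by (meson finite_PiE finite_imageI finite_lessThan finite_subset)
qed

lemma Union_join_cover:
  assumes "interval_map f" "\<Union>\<U> = unitI"
  shows "\<Union>(join_cover f \<U> n) = unitI"
proof
  show "\<Union>(join_cover f \<U> n) \<subseteq> unitI" unfolding join_cover_def by blast
  show "unitI \<subseteq> \<Union>(join_cover f \<U> n)"
  proof
    fix x assume x: "x \<in> unitI"
    have "\<forall>i. \<exists>U\<in>\<U>. (f ^^ i) x \<in> U"
      using funpow_in_unitI[OF assms(1) x] assms(2) by blast
    then obtain s where s: "\<And>i. s i \<in> \<U>" "\<And>i. (f ^^ i) x \<in> s i" by metis
    then have "{y \<in> unitI. \<forall>i<n. (f ^^ i) y \<in> s i} \<in> join_cover f \<U> n"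
      by (intro join_coverI)
    then show "x \<in> \<Union>(join_cover f \<U> n)" using s x by blast
  qed
qed

lemma min_subcover_attained:
  assumes "finite \<W>" "\<Union>\<W> = unitI"
  obtains \<V> where "\<V> \<subseteq> \<W>" "\<Union>\<V> = unitI" "finite \<V>" "card \<V> = min_subcover \<W>"
proof -
  have "\<exists>m. \<exists>\<V>\<subseteq>\<W>. \<Union>\<V> = unitI \<and> card \<V> = m \<and> finite \<V>" using assms by blast
  then have "\<exists>\<V>\<subseteq>\<W>. \<Union>\<V> = unitI \<and> card \<V> = min_subcover \<W> \<and> finite \<V>"
    unfolding min_subcover_def by (rule LeastI_ex)
  then show ?thesis using that by blast
qed

lemma min_subcover_le:
  assumes "\<V> \<subseteq> \<W>" "\<Union>\<V> = unitI" "finite \<V>"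
  shows "min_subcover \<W> \<le> card \<V>"
  unfolding min_subcover_def using assms by (intro Least_le) blast

text \<open>Forgetting the last entry of an itinerary enlarges an element of the join. Doing so
  throughout a subcover gives a subcover of the coarser join with at most as many elements.\<close>

lemma min_subcover_join_Suc:
  assumes "interval_map f" "finite \<U>" "\<Union>\<U> = unitI"
  shows "min_subcover (join_cover f \<U> n) \<le> min_subcover (join_cover f \<U> (Suc n))"
proof -
  obtain \<V> where V: "\<V> \<subseteq> join_cover f \<U> (Suc n)" "\<Union>\<V> = unitI" "finite \<V>"
    "card \<V> = min_subcover (join_cover f \<U> (Suc n))"
    using min_subcover_attained[OF finite_join_cover[OF assms(2)] Union_join_cover[OF assms(1,3)]]
    by metis
  have "\<exists>D\<in>join_cover f \<U> n. E \<subseteq> D" if E: "E \<in> join_cover f \<U> (Suc n)" for E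
  proof -
    obtain s where s: "\<forall>i<Suc n. s i \<in> \<U>" "E = {x \<in> unitI. \<forall>i<Suc n. (f ^^ i) x \<in> s i}"
      using E unfolding join_cover_mem_iff by blast
    have "{x \<in> unitI. \<forall>i<n. (f ^^ i) x \<in> s i} \<in> join_cover f \<U> n"
      using s(1) by (intro join_coverI) simp
    then show ?thesis using s(2) less_SucI by (intro bexI) auto
  qed
  then obtain g where g: "\<And>E. E \<in> join_cover f \<U> (Suc n) \<Longrightarrow> g E \<in> join_cover f \<U> n \<and> E \<subseteq> g E"
    by metis
  have "g ` \<V> \<subseteq> join_cover f \<U> n" using g V(1) by blast
  moreover have "\<Union>(g ` \<V>) = unitI"
  proof
    show "\<Union>(g ` \<V>) \<subseteq> unitI"
      using \<open>g ` \<V> \<subseteq> join_cover f \<U> n\<close> Union_join_cover[OF assms(1,3), of n] by blast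
    show "unitI \<subseteq> \<Union>(g ` \<V>)" using g V(1,2) by blast
  qed
  ultimately have "min_subcover (join_cover f \<U> n) \<le> card (g ` \<V>)"
    using V(3) by (intro min_subcover_le) auto
  also have "\<dots> \<le> card \<V>" using V(3) by (rule card_image_le)
  finally show ?thesis using V(4) by simp
qed

text \<open>The sequence is increasing, so \<open>lim\<close> is a genuine limit in
  \<open>enat\<close>. As a supremum, the complexity can be bounded below at a single
  \<open>n\<close> and above uniformly in \<open>n\<close>.\<close>

lemma complexity_eq_SUP:
  assumes "interval_map f" "finite \<U>" "\<Union>\<U> = unitI"
  shows "complexity f \<U> = (SUP n. enat (min_subcover (join_cover f \<U> n)))"
proof -
  have "incseq (\<lambda>n. enat (min_subcover (join_cover f \<U> n)))"
    using min_subcover_join_Suc[OF assms] by (intro incseq_SucI) auto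
  then show ?thesis unfolding complexity_def by (intro limI LIMSEQ_SUP)
qed

text \<open>For every \<open>n\<close>, the two elements of the join belonging to \<open>s\<close>
  and \<open>t\<close> already form a subcover; they may coincide.\<close>

lemma complexity_le_2:
  assumes "interval_map f" "finite \<U>" "\<Union>\<U> = unitI"
    and "\<And>i. s i \<in> \<U>" "\<And>i. t i \<in> \<U>"
    and "\<And>x. x \<in> unitI \<Longrightarrow> (\<forall>i. (f ^^ i) x \<in> s i) \<or> (\<forall>i. (f ^^ i) x \<in> t i)"
  shows "complexity f \<U> \<le> 2"
proof -
  have "enat (min_subcover (join_cover f \<U> n)) \<le> 2" for n
  proof -
    let ?E = "\<lambda>s. {x \<in> unitI. \<forall>i<n. (f ^^ i) x \<in> s i}"
    have "{?E s, ?E t} \<subseteq> join_cover f \<U> n"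
      using join_coverI[of n s \<U> f] join_coverI[of n t \<U> f] assms(4,5) by simp
    moreover have "\<Union>{?E s, ?E t} = unitI"
    proof -
      have "x \<in> ?E s \<union> ?E t" if "x \<in> unitI" for x using assms(6)[OF that] that by auto
      then show ?thesis by auto
    qed
    ultimately have "min_subcover (join_cover f \<U> n) \<le> card {?E s, ?E t}"
      by (intro min_subcover_le) auto
    also have "\<dots> \<le> 2" by (simp add: card_insert_if)
    finally show ?thesis by (metis enat_ord_simps(1) numeral_eq_enat)
  qed
  then show ?thesis unfolding complexity_eq_SUP[OF assms(1-3)] by (intro SUP_least)
qed

text \<open>A name for the second of the four equivalent conditions. Here \<open>U1\<close> and
  \<open>U2\<close> are automatically distinct, since equal sets covering the interval would be
  dense.\<close>

definition nondense_covers_complex :: "(real \<Rightarrow> real) \<Rightarrow> bool" where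
  "nondense_covers_complex f \<longleftrightarrow>
     (\<forall>U1 U2. openI U1 \<and> openI U2 \<and> U1 \<union> U2 = unitI \<and>
        closure U1 \<noteq> unitI \<and> closure U2 \<noteq> unitI \<longrightarrow> complexity f {U1, U2} > 2)"

text \<open>With at most one element in \<open>J\<close> the ratios are at most \<open>1 / n\<close>
  and tend to \<open>0\<close>.\<close>

lemma positive_density_two_elements:
  assumes "positive_density J"
  obtains i j where "i \<in> J" "j \<in> J" "i < j"
proof (rule ccontr)
  assume *: "\<not> thesis"
  then have eq: "i = j" if "i \<in> J" "j \<in> J" for i j
    using that \<open>\<And>j i. i \<in> J \<Longrightarrow> j \<in> J \<Longrightarrow> i < j \<Longrightarrow> thesis\<close> by (meson linorder_neqE_nat)
  obtain d where d: "d > 0" "(\<lambda>n. real (card (J \<inter> {..<n})) / real n) \<longlonglongrightarrow> d"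
    using assms unfolding positive_density_def by blast
  have "card (J \<inter> {..<n}) \<le> 1" for n
    using eq by (subst One_nat_def, subst card_le_Suc0_iff_eq) auto
  then have "real (card (J \<inter> {..<n})) / real n \<le> 1 / real n" for n
    by (intro divide_right_mono) (auto simp: of_nat_le_1_iff)
  then have "d \<le> 0"
    by (intro LIMSEQ_le[OF d(2) lim_1_over_n]) auto
  then show False using d by simp
qed

text \<open>Let \<open>i < j\<close> be independent times for the exteriors \<open>W 1\<close> and
  \<open>W 2\<close>. Points realizing the patterns 11, 12 and 21 differ pairwise at time
  \<open>i\<close> or \<open>j\<close>, one being in \<open>W 1\<close> and the other in
  \<open>W 2\<close>. An element of the join prescribes \<open>U1\<close> or \<open>U2\<close> at
  that time and so excludes one of the two.\<close>

lemma upe_imp_nondense_covers_complex: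
  assumes f: "interval_map f" and upe: "uniformly_positive_entropy f"
  shows "nondense_covers_complex f"
  unfolding nondense_covers_complex_def
proof (intro allI impI, elim conjE)
  fix U1 U2
  assume o: "openI U1" "openI U2" and cov: "U1 \<union> U2 = unitI"
    and nd: "closure U1 \<noteq> unitI" "closure U2 \<noteq> unitI"
  have sub: "closure U \<subseteq> unitI" if "openI U" for U
    using openI_subset[OF that] closure_minimal[of U unitI] by (simp add: unitI_def)
  obtain x1 where x1: "x1 \<in> unitI" "x1 \<notin> closure U1" using sub[OF o(1)] nd(1) by blast
  obtain x2 where x2: "x2 \<in> unitI" "x2 \<notin> closure U2" using sub[OF o(2)] nd(2) by blast
  define W where "W = (\<lambda>j::nat. unitI - closure (if j = 1 then U1 else U2))"
  have W: "openI (W j)" for j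
    unfolding W_def Diff_eq by (intro openI_inter_open) auto
  \<comment> \<open>A common point would lie outside both closures, hence outside the cover.\<close>
  have "x1 \<noteq> x2" using x1 x2 cov closure_subset by blast
  then have "IE_tuple f 2 (\<lambda>j. if j = 1 then x1 else x2)"
    using upe x1 x2 unfolding uniformly_positive_entropy_def by blast
  moreover have "\<forall>j\<in>{1..2}. neighborhoodI (if j = 1 then x1 else x2) (W j)"
    using W x1 x2 openI_subset unfolding neighborhoodI_def
    by (auto intro!: exI[of _ "W _"] simp: W_def split: if_splits)
  ultimately obtain J where J: "independence_set f 2 W J" "positive_density J"
    unfolding IE_tuple_def by blast
  obtain i j where ij: "i \<in> J" "j \<in> J" "i < j"
    using positive_density_two_elements[OF J(2)] .
  have pt: "\<exists>x\<in>unitI. (f ^^ i) x \<in> W a \<and> (f ^^ j) x \<in> W b" if "a \<in> {1..2}" "b \<in> {1..2}" for a b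
  proof -
    have "(\<Inter>l\<in>{i, j}. preI f l (W ((\<lambda>l. if l = i then a else b) l))) \<noteq> {}"
      using J(1) ij that unfolding independence_set_def
      by (elim allE[of _ "{i, j}"] allE[of _ "\<lambda>l. if l = i then a else b"]) auto
    then show ?thesis using ij(3) unfolding preI_def by auto
  qed
  obtain x where x: "x \<in> unitI" "(f ^^ i) x \<in> W 1" "(f ^^ j) x \<in> W 1" using pt[of 1 1] by auto
  obtain y where y: "y \<in> unitI" "(f ^^ i) y \<in> W 1" "(f ^^ j) y \<in> W 2" using pt[of 1 2] by auto
  obtain z where z: "z \<in> unitI" "(f ^^ i) z \<in> W 2" "(f ^^ j) z \<in> W 1" using pt[of 2 1] by auto
  have W1: "w \<notin> U1" if "w \<in> W 1" for w using that closure_subset unfolding W_def by auto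
  have W2: "w \<notin> U2" if "w \<in> W 2" for w using that closure_subset unfolding W_def by auto
  \<comment> \<open>The join of length \<open>j + 1\<close> is the first that records time
    \<open>j\<close>.\<close>
  let ?n = "Suc j"
  have U: "finite {U1, U2}" "\<Union>{U1, U2} = unitI" using cov by auto
  obtain \<V> where V: "\<V> \<subseteq> join_cover f {U1, U2} ?n" "\<Union>\<V> = unitI" "finite \<V>"
    "card \<V> = min_subcover (join_cover f {U1, U2} ?n)"
    using min_subcover_attained[OF finite_join_cover[OF U(1)] Union_join_cover[OF f U(2)]]
    by metis
  have sep: "\<not> (p \<in> E \<and> q \<in> E)"
    if E: "E \<in> \<V>" and l: "l < ?n"
      and pq: "(f ^^ l) p \<in> W 1" "(f ^^ l) q \<in> W 2" for p q l E
  proof -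
    have "E \<in> join_cover f {U1, U2} ?n" using E V(1) by blast
    then obtain s where s: "\<forall>i<?n. s i \<in> {U1, U2}" "E = {x \<in> unitI. \<forall>i<?n. (f ^^ i) x \<in> s i}"
      unfolding join_cover_mem_iff by blast
    then have "s l = U1 \<or> s l = U2" using l by blast
    moreover have "(f ^^ l) p \<in> s l \<and> (f ^^ l) q \<in> s l" if "p \<in> E \<and> q \<in> E"
      using that s(2) l by blast
    ultimately show ?thesis using W1[OF pq(1)] W2[OF pq(2)] by metis
  qed
  obtain X where X: "X \<in> \<V>" "x \<in> X" using V(2) x by blast
  obtain Y where Y: "Y \<in> \<V>" "y \<in> Y" using V(2) y by blast
  obtain Z where Z: "Z \<in> \<V>" "z \<in> Z" using V(2) z by blast
  have "i < ?n" "j < ?n" using ij by auto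
  have "X \<noteq> Y" using sep[OF X(1) \<open>j < ?n\<close> x(3) y(3)] X Y by blast
  moreover have "X \<noteq> Z" using sep[OF X(1) \<open>i < ?n\<close> x(2) z(2)] X Z by blast
  moreover have "Y \<noteq> Z" using sep[OF Y(1) \<open>i < ?n\<close> y(2) z(2)] Y Z by blast
  ultimately have "card {X, Y, Z} = 3" by auto
  moreover have "card {X, Y, Z} \<le> card \<V>" using X Y Z V(3) by (intro card_mono) auto
  ultimately have "3 \<le> min_subcover (join_cover f {U1, U2} ?n)" using V(4) by simp
  then have "enat 3 \<le> enat (min_subcover (join_cover f {U1, U2} ?n))" by simp
  also have "\<dots> \<le> complexity f {U1, U2}"
    unfolding complexity_eq_SUP[OF f U] by (intro SUP_upper) auto
  finally show "complexity f {U1, U2} > 2"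
    by (rule less_le_trans[rotated]) (simp add: numeral_eq_enat)
qed

section \<open>Dynamics forced by complex covers\<close>

text \<open>The sequences \<open>s\<close> and \<open>t\<close> name the interval to be avoided at
  each time. If every orbit complied with one of them, two elements of the join would suffice for
  the cover by the two complements.\<close>

lemma two_itineraries_blocked:
  fixes s t :: "nat \<Rightarrow> bool"
  assumes f: "interval_map f" and cc: "nondense_covers_complex f"
    and 1: "0 \<le> p1" "p1 < q1" "q1 \<le> 1" and 2: "0 \<le> p2" "p2 < q2" "q2 \<le> 1"
    and disj: "{p1..q1} \<inter> {p2..q2} = {}"
  shows "\<exists>x\<in>unitI. (\<exists>i. (f ^^ i) x \<in> (if s i then {p1..q1} else {p2..q2})) \<and>
                    (\<exists>i. (f ^^ i) x \<in> (if t i then {p1..q1} else {p2..q2}))"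
proof (rule ccontr)
  assume neg: "\<not> ?thesis"
  have nd: "closure (unitI - {p..q}) \<noteq> unitI" if "0 \<le> p" "p < q" "q \<le> 1" for p q
  proof -
    have "{p<..<q} \<inter> (unitI - {p..q}) = {}" by auto
    then have "{p<..<q} \<inter> closure (unitI - {p..q}) = {}"
      by (simp add: open_Int_closure_eq_empty)
    moreover have "(p + q) / 2 \<in> {p<..<q}" "(p + q) / 2 \<in> unitI"
      using that by (auto simp: unitI_def)
    ultimately show ?thesis by blast
  qed
  define U where "U = (\<lambda>b. unitI - (if b then {p1..q1} else {p2..q2}))"
  have U: "openI (U b)" "closure (U b) \<noteq> unitI" for b
    unfolding U_def using nd 1 2 by (auto simp: openI_minus_interval)
  have cov: "U True \<union> U False = unitI" unfolding U_def using disj by auto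
  have "complexity f {U True, U False} > 2"
    using cc[unfolded nondense_covers_complex_def, rule_format, of "U True" "U False"] U cov by simp
  moreover have "complexity f {U True, U False} \<le> 2"
  proof (rule complexity_le_2[where s="\<lambda>i. U (s i)" and t="\<lambda>i. U (t i)"])
    fix x assume x: "x \<in> unitI"
    then show "(\<forall>i. (f ^^ i) x \<in> U (s i)) \<or> (\<forall>i. (f ^^ i) x \<in> U (t i))"
      using neg funpow_in_unitI[OF f x] unfolding U_def by blast
  next
    show "U (s i) \<in> {U True, U False}" for i by (cases "s i") auto
    show "U (t i) \<in> {U True, U False}" for i by (cases "t i") auto
  qed (use f cov in auto)
  ultimately show False by simp
qed

text \<open>If \<open>U\<close> never reaches \<open>V\<close> but \<open>V\<close> reaches \<open>U\<close>, first at time \<open>n\<close>, then the part of \<open>V\<close>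
  that is in \<open>U\<close> at time \<open>n\<close> is wandering, so no orbit meets two disjoint subintervals of it.\<close>

lemma nondense_covers_complex_imp_transitive:
  assumes f: "interval_map f" and cc: "nondense_covers_complex f"
    and UV: "openI U" "U \<noteq> {}" "openI V" "V \<noteq> {}"
  shows "\<exists>n. (f ^^ n) ` U \<inter> V \<noteq> {}"
proof (rule ccontr)
  assume neg: "\<not> ?thesis"
  then have never: "(f ^^ n) x \<notin> V" if "x \<in> U" for n x using that by blast
  have shift: "(f ^^ j) x = (f ^^ (j - i)) ((f ^^ i) x)" if "i \<le> j" for i j x
    using that by (metis add.commute comp_apply funpow_add le_add_diff_inverse)
  show False
  proof (cases "\<exists>n. \<exists>x\<in>V. (f ^^ n) x \<in> U")
    case False
    \<comment> \<open>Neither set reaches the other, so no orbit can visit both an interval in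
      \<open>U\<close> and one in \<open>V\<close>, against the two constant sequences.\<close>
    obtain p1 q1 where 1: "0 < p1" "p1 < q1" "q1 < 1" "{p1..q1} \<subseteq> U"
      using openI_contains_interval UV by metis
    obtain p2 q2 where 2: "0 < p2" "p2 < q2" "q2 < 1" "{p2..q2} \<subseteq> V"
      using openI_contains_interval UV by metis
    have "U \<inter> V = {}" using never[where n=0] by auto
    then have "{p1..q1} \<inter> {p2..q2} = {}" using 1(4) 2(4) by blast
    then obtain x i j where "x \<in> unitI" "(f ^^ i) x \<in> {p1..q1}" "(f ^^ j) x \<in> {p2..q2}"
      using two_itineraries_blocked[OF f cc, of p1 q1 p2 q2 "\<lambda>_. True" "\<lambda>_. False"] 1 2 by auto
    then have "(f ^^ i) x \<in> U" "(f ^^ j) x \<in> V" using 1 2 by auto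
    then show False using False never shift[of i j x] shift[of j i x]
      by (metis nat_le_linear)
  next
    case True
    define n where "n = (LEAST n. \<exists>x\<in>V. (f ^^ n) x \<in> U)"
    have n: "\<exists>x\<in>V. (f ^^ n) x \<in> U" unfolding n_def using True by (rule LeastI_ex)
    have least: "(f ^^ m) x \<notin> U" if "m < n" "x \<in> V" for m x
      using not_less_Least[of m "\<lambda>n. \<exists>x\<in>V. (f ^^ n) x \<in> U"] that unfolding n_def by blast
    define W where "W = V \<inter> preI f n U"
    have "openI W" "W \<noteq> {}"
      using UV n openI_subset[OF UV(3)] openI_preI[OF f] openI_Int unfolding W_def preI_def by auto
    have wander: "(f ^^ m) x \<notin> W" if "m > 0" "x \<in> W" for m x
    \<comment> \<open>A return before time \<open>n\<close> would let a point of \<open>V\<close>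
      reach \<open>U\<close> in \<open>n - m\<close> steps, too early; a later one would lead from
      \<open>U\<close> to \<open>V\<close>.\<close>
    proof (cases "m < n")
      case True
      have "(f ^^ n) x \<in> U" using that unfolding W_def preI_def by auto
      then have "(f ^^ (n - m)) ((f ^^ m) x) \<in> U" using shift[of m n x] True by auto
      then show ?thesis using least[of "n - m"] True that unfolding W_def by auto
    next
      case False
      have "(f ^^ n) x \<in> U" using that unfolding W_def preI_def by auto
      then show ?thesis using never[of "(f ^^ n) x" "m - n"] shift[of n m x] False
        unfolding W_def by auto
    qed
    obtain p q where pq: "0 < p" "p < q" "q < 1" "{p..q} \<subseteq> W"
      using openI_contains_interval \<open>openI W\<close> \<open>W \<noteq> {}\<close> by metis
    \<comment> \<open>The outer thirds of \<open>{p..q}\<close> are disjoint, so an orbit visiting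
      both does so at different times and returns to \<open>W\<close>.\<close>
    define d where "d = (q - p) / 3"
    have d: "d > 0" "p + 3 * d = q" using pq unfolding d_def by (auto simp: field_simps)
    have "{p..p + d} \<inter> {q - d..q} = {}" using d by auto
    then obtain x i j where x: "x \<in> unitI" "(f ^^ i) x \<in> {p..p + d}" "(f ^^ j) x \<in> {q - d..q}"
      using two_itineraries_blocked[OF f cc, of p "p + d" "q - d" q "\<lambda>_. True" "\<lambda>_. False"] pq d
      by auto
    then have W: "(f ^^ i) x \<in> W" "(f ^^ j) x \<in> W" using pq d by auto
    have "i \<noteq> j" using x d by auto
    then consider "i < j" | "j < i" by linarith
    then show False
    proof cases
      case 1
      then show ?thesis using W(2) wander[OF _ W(1), of "j - i"] shift[of i j x] by simp
    next
      case 2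
      then show ?thesis using W(1) wander[OF _ W(2), of "i - j"] shift[of j i x] by simp
    qed
  qed
qed

text \<open>Even iterates preserve the two sides of \<open>z\<close> and odd ones exchange them.
  With the blocked interval alternating in time, one sequence can only be hit from the left of
  \<open>z\<close> and the other only from the right, so no point hits both.\<close>

lemma nondense_covers_complex_imp_no_swap:
  assumes f: "interval_map f" and cc: "nondense_covers_complex f"
    and z: "0 < z" "z < 1"
    and swap: "\<And>x. x \<in> {0..z} \<Longrightarrow> f x \<in> {z..1}" "\<And>x. x \<in> {z..1} \<Longrightarrow> f x \<in> {0..z}"
  shows False
proof -
  have even_odd: "(even i \<longrightarrow> (x \<in> {0..z} \<longrightarrow> (f ^^ i) x \<in> {0..z}) \<and> (x \<in> {z..1} \<longrightarrow> (f ^^ i) x \<in> {z..1})) \<and>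
    (odd i \<longrightarrow> (x \<in> {0..z} \<longrightarrow> (f ^^ i) x \<in> {z..1}) \<and> (x \<in> {z..1} \<longrightarrow> (f ^^ i) x \<in> {0..z}))" for i x
    by (induction i) (use swap in auto)
  \<comment> \<open>Both intervals keep away from \<open>z\<close>, so that the side of a hit is
    unambiguous.\<close>
  have "\<exists>x\<in>unitI.
      (\<exists>i. (f ^^ i) x \<in> (if even i then {z / 3..z / 2} else {(1 + z) / 2..1})) \<and>
      (\<exists>i. (f ^^ i) x \<in> (if odd i then {z / 3..z / 2} else {(1 + z) / 2..1}))"
    by (rule two_itineraries_blocked[OF f cc]) (use z in auto)
  then obtain x i j where x: "x \<in> unitI"
    "(f ^^ i) x \<in> (if even i then {z / 3..z / 2} else {(1 + z) / 2..1})"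
    "(f ^^ j) x \<in> (if odd j then {z / 3..z / 2} else {(1 + z) / 2..1})" by blast
  have "x \<in> {0..z} \<or> x \<in> {z..1}" using x(1) by (auto simp: unitI_def)
  then show False
    using x(2,3) even_odd[of i x] even_odd[of j x] z by (auto split: if_splits)
qed

subsection \<open>Transitive interval maps\<close>

text \<open>A locale allows the results on the right of a fixed point to be applied also to the
  reflected map, which gives those on the left.\<close>

locale transitive_interval_map =
  fixes f :: "real \<Rightarrow> real"
  assumes f: "interval_map f"
    and transitive: "\<And>U V. openI U \<Longrightarrow> U \<noteq> {} \<Longrightarrow> openI V \<Longrightarrow> V \<noteq> {} \<Longrightarrow>
      \<exists>n. (f ^^ n) ` U \<inter> V \<noteq> {}"
begin

lemma openI_open_interval: "0 \<le> a \<Longrightarrow> b \<le> 1 \<Longrightarrow> openI {a<..<b}"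
  using openI_inter_open[of "{a<..<b}"] by (auto simp: unitI_def Int_absorb1 subset_iff)

lemma meets:
  assumes "0 \<le> a" "a < b" "b \<le> 1" "0 \<le> c" "c < d" "d \<le> 1"
  shows "\<exists>n. \<exists>x\<in>{a<..<b}. (f ^^ n) x \<in> {c<..<d}"
  using transitive[OF openI_open_interval[of a b] _ openI_open_interval[of c d]] assms by force

text \<open>Otherwise the open complement of the compact image contains an interval. Transitivity
  moves a point from its left half to its right half in a positive number of steps, hence into the
  image.\<close>

lemma surjective: "(f ^^ n) ` unitI = unitI"
proof (induction n)
  case (Suc n)
  have "f ` unitI = unitI"
  proof (rule ccontr)
    assume neq: "f ` unitI \<noteq> unitI"
    have cont: "continuous_on unitI f" and sub: "f ` unitI \<subseteq> unitI"
      using f by (auto simp: interval_map_def)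
    have "closed (f ` unitI)"
      using cont by (intro compact_imp_closed compact_continuous_image) (auto simp: unitI_def)
    then have "openI (unitI - f ` unitI)"
      using openI_inter_open[of "- (f ` unitI)"] by (simp add: Diff_eq open_Compl)
    moreover have "unitI - f ` unitI \<noteq> {}" using neq sub by blast
    ultimately obtain p q where pq: "0 < p" "p < q" "q < 1" "{p..q} \<subseteq> unitI - f ` unitI"
      using openI_contains_interval by metis
    obtain n x where x: "x \<in> {p<..<(p + q) / 2}" "(f ^^ n) x \<in> {(p + q) / 2<..<q}"
      using meets[of p "(p + q) / 2" "(p + q) / 2" q] pq by auto
    have "x \<in> unitI" using x pq by (auto simp: unitI_def)
    show False
    proof (cases n)
      case 0
      then show ?thesis using x by auto
    next
      case (Suc m)
      then have "(f ^^ n) x \<in> f ` unitI" using funpow_in_unitI[OF f \<open>x \<in> unitI\<close>, of m] by simp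
      moreover have "(f ^^ n) x \<in> {p..q}" using x pq by auto
      ultimately show ?thesis using pq by blast
    qed
  qed
  then show ?case using Suc by (metis funpow.simps(2) image_comp)
qed simp

text \<open>Transitivity is applied to the preimage of the target under \<open>f ^^ N\<close>,
  nonempty by surjectivity; this adds \<open>N\<close> to the time found.\<close>

lemma meets_late:
  assumes "0 \<le> a" "a < b" "b \<le> 1" "0 \<le> c" "c < d" "d \<le> 1"
  shows "\<exists>n\<ge>N. \<exists>x\<in>{a<..<b}. (f ^^ n) x \<in> {c<..<d}"
proof -
  have "(c + d) / 2 \<in> (f ^^ N) ` unitI" unfolding surjective using assms by (auto simp: unitI_def)
  then obtain w where "w \<in> unitI" "(f ^^ N) w = (c + d) / 2" by auto
  then have "w \<in> preI f N {c<..<d}" using assms by (auto simp: preI_def)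
  then obtain n where "(f ^^ n) ` {a<..<b} \<inter> preI f N {c<..<d} \<noteq> {}"
    using transitive[of "{a<..<b}" "preI f N {c<..<d}"] openI_open_interval
      openI_preI[OF f] assms by (metis empty_iff greaterThanLessThan_empty_iff not_le)
  then obtain x where "x \<in> {a<..<b}" "(f ^^ (N + n)) x \<in> {c<..<d}"
    unfolding preI_def funpow_add by fastforce
  then show ?thesis by (intro exI[of _ "N + n"]) auto
qed

text \<open>Without one, \<open>f x - x\<close> has constant sign on the open interval. Orbits are
  then monotone and cannot pass between the two halves in both directions.\<close>

lemma interior_fixed_point: "\<exists>z. 0 < z \<and> z < 1 \<and> f z = z"
proof (rule ccontr)
  assume neg: "\<not> ?thesis"
  have cont: "continuous_on {0..1} (\<lambda>x. f x - x)"
    using f unfolding interval_map_def unitI_def by (auto intro!: continuous_intros)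
  have conn: "connected ((\<lambda>x. f x - x) ` {0<..<1})"
    using cont by (intro connected_continuous_image continuous_on_subset[OF cont]) auto
  have no0: "0 \<notin> (\<lambda>x. f x - x) ` {0<..<1}" using neg by auto
  have cl: "closure {0<..<1::real} = {0..1}" by simp
  consider "\<And>x. x \<in> {0<..<1} \<Longrightarrow> f x > x" | "\<And>x. x \<in> {0<..<1} \<Longrightarrow> f x < x"
  proof -
    have "\<not> (\<exists>x\<in>{0<..<1}. \<exists>y\<in>{0<..<1}. f x < x \<and> f y > y)"
    proof
      assume "\<exists>x\<in>{0<..<1}. \<exists>y\<in>{0<..<1}. f x < x \<and> f y > y"
      then obtain x y where xy: "x \<in> {0<..<1}" "y \<in> {0<..<1}" "f x - x < 0" "f y - y > 0" by auto
      have "{f x - x..f y - y} \<subseteq> (\<lambda>x. f x - x) ` {0<..<1}"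
        using xy by (intro connected_contains_Icc[OF conn]) auto
      moreover have "0 \<in> {f x - x..f y - y}" using xy by simp
      ultimately show False using no0 by blast
    qed
    moreover have "f x \<noteq> x" if "x \<in> {0<..<1}" for x using neg that by auto
    ultimately show ?thesis using that by (meson linorder_neqE)
  qed
  then show False
  proof cases
    case 1
    \<comment> \<open>Continuity includes the end points, which an orbit may hit.\<close>
    have ge: "f x \<ge> x" if "x \<in> {0..1}" for x
      using continuous_ge_on_closure[of "{0<..<1}" "\<lambda>x. f x - x" x 0] cont 1 that
      unfolding cl by (auto simp: less_imp_le)
    have inv: "(f ^^ n) x \<ge> x" if "x \<in> {0..1}" for n x
    proof (induction n)
      case (Suc n)
      have "(f ^^ n) x \<in> {0..1}" using funpow_in_unitI[OF f, of x n] that by (simp add: unitI_def)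
      then show ?case using ge[of "(f ^^ n) x"] Suc by simp
    qed simp
    obtain n x where "x \<in> {1/2<..<1}" "(f ^^ n) x \<in> {0<..<1/2}" using meets[of "1/2" 1 0 "1/2"] by auto
    then show False using inv[of x n] by auto
  next
    case 2
    have le: "f x \<le> x" if "x \<in> {0..1}" for x
      using continuous_le_on_closure[of "{0<..<1}" "\<lambda>x. f x - x" x 0] cont 2 that
      unfolding cl by (auto simp: less_imp_le)
    have inv: "(f ^^ n) x \<le> x" if "x \<in> {0..1}" for n x
    proof (induction n)
      case (Suc n)
      have "(f ^^ n) x \<in> {0..1}" using funpow_in_unitI[OF f, of x n] that by (simp add: unitI_def)
      then show ?case using le[of "(f ^^ n) x"] Suc by simp
    qed simp
    obtain n x where "x \<in> {0<..<1/2}" "(f ^^ n) x \<in> {1/2<..<1}" using meets[of 0 "1/2" "1/2" 1] by auto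
    then show False using inv[of x n] by auto
  qed
qed

lemma funpow_fixed: "f z = z \<Longrightarrow> (f ^^ n) z = z"
  by (induction n) auto

text \<open>Every image contains the fixed point \<open>z\<close>, and transitivity provides an
  image with a point beyond \<open>c\<close>; connectedness fills the gap.\<close>

lemma germ_covers_right:
  assumes z: "f z = z" "0 < z" "z < 1" and uv: "0 \<le> u" "u < v" "v \<le> 1" "z \<in> {u..v}"
    and c: "c < 1"
  shows "\<exists>n. {z..c} \<subseteq> (f ^^ n) ` {u..v}"
proof -
  obtain n x where x: "x \<in> {u<..<v}" "(f ^^ n) x \<in> {max z c<..<1}"
    using meets[of u v "max z c" 1] uv c z by (auto simp: le_max_iff_disj)
  have "{z..(f ^^ n) x} \<subseteq> (f ^^ n) ` {u..v}"
    using x uv funpow_fixed[OF z(1), of n]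
    by (intro funpow_image_contains_interval[OF f]) (auto intro!: image_eqI[of z _ z])
  moreover have "{z..c} \<subseteq> {z..(f ^^ n) x}" using x by auto
  ultimately show ?thesis by blast
qed

lemma germ_covers_left:
  assumes z: "f z = z" "0 < z" "z < 1" and uv: "0 \<le> u" "u < v" "v \<le> 1" "z \<in> {u..v}"
    and a: "0 < a"
  shows "\<exists>n. {a..z} \<subseteq> (f ^^ n) ` {u..v}"
proof -
  obtain n x where x: "x \<in> {u<..<v}" "(f ^^ n) x \<in> {0<..<min z a}"
    using meets[of u v 0 "min z a"] uv a z by (auto simp: min_le_iff_disj)
  have "{(f ^^ n) x..z} \<subseteq> (f ^^ n) ` {u..v}"
    using x uv funpow_fixed[OF z(1), of n]
    by (intro funpow_image_contains_interval[OF f]) (auto intro!: image_eqI[of z _ z])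
  moreover have "{a..z} \<subseteq> {(f ^^ n) x..z}" using x by auto
  ultimately show ?thesis by blast
qed

lemma funpow_image_multiple:
  assumes "R \<subseteq> (f ^^ j) ` R"
  shows "R \<subseteq> (f ^^ (q * j)) ` R"
proof (induction q)
  case (Suc q)
  then show ?case using funpow_image_trans[OF assms Suc] by simp
qed simp

text \<open>\<open>{z..c}\<close> covers itself after both \<open>j\<close> and \<open>j + 1\<close> steps for some \<open>j\<close>, hence after
  any sufficiently large number of steps.\<close>

lemma right_germ_eventually_covers:
  assumes z: "f z = z" "0 < z" "z < 1" and c: "z < c" "c < 1" "f c > z"
    and ab: "0 < a" "b < 1"
  shows "\<exists>N. \<forall>n\<ge>N. {a..b} \<subseteq> (f ^^ n) ` {z..c}"
proof -
  let ?R = "{z..c}"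
  \<comment> \<open>The interval \<open>{z..e}\<close> lies both in \<open>?R\<close> and in its
    image. Once it covers \<open>?R\<close> after \<open>j\<close> steps, \<open>?R\<close> covers
    itself after \<open>j\<close> and after \<open>j + 1\<close> steps.\<close>
  define e where "e = min c (f c)"
  have e: "z < e" "e \<le> c" "e \<le> f c" unfolding e_def using c by auto
  have "{z..f c} \<subseteq> (f ^^ 1) ` ?R"
    using z c by (intro funpow_image_contains_interval[OF f]) (auto intro!: image_eqI[of z _ z])
  then have 1: "{z..e} \<subseteq> (f ^^ 1) ` ?R" using e by auto
  obtain j where j: "?R \<subseteq> (f ^^ j) ` {z..e}"
    using germ_covers_right[OF z, of z e c] e c z by auto
  have Rj: "?R \<subseteq> (f ^^ j) ` ?R" using j e by fastforce
  have Rj1: "?R \<subseteq> (f ^^ (j + 1)) ` ?R"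
    using funpow_image_trans[OF 1 j] by simp
  have R: "?R \<subseteq> (f ^^ n) ` ?R" if n: "n \<ge> j * j" for n
  proof (cases "j = 0")
    case True
    then show ?thesis using funpow_image_multiple[OF Rj1, of n] by simp
  next
    case False
    define q r where "q = n div j" and "r = n mod j"
    have "r < j" "n = q * j + r" unfolding q_def r_def using False by auto
    moreover have "j \<le> q" unfolding q_def using n False by (simp add: less_eq_div_iff_mult_less_eq)
    \<comment> \<open>The bound \<open>j * j\<close> on \<open>n\<close> ensures
      \<open>r < j \<le> q\<close>, so \<open>n\<close> splits into \<open>q - r\<close> blocks of
      length \<open>j\<close> and \<open>r\<close> of length \<open>j + 1\<close>.\<close>
    ultimately have "n = (q - r) * j + r * (j + 1)"
      by (simp add: algebra_simps diff_mult_distrib)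
    then show ?thesis
      using funpow_image_trans[OF funpow_image_multiple[OF Rj, of "q - r"]
          funpow_image_multiple[OF Rj1, of r]] by simp
  qed
  obtain k where k: "{z..b} \<subseteq> (f ^^ k) ` ?R"
    using germ_covers_right[OF z, of z c b] c ab z by auto
  obtain l where l: "{a..z} \<subseteq> (f ^^ l) ` ?R"
    using germ_covers_left[OF z, of z c a] c ab z by auto
  show ?thesis
  proof (intro exI allI impI)
    fix n assume n: "j * j + k + l \<le> n"
    have "{z..b} \<subseteq> (f ^^ ((n - k) + k)) ` ?R" using n by (intro funpow_image_trans[OF R k]) auto
    moreover have "{a..z} \<subseteq> (f ^^ ((n - l) + l)) ` ?R" using n by (intro funpow_image_trans[OF R l]) auto
    ultimately have "{z..b} \<union> {a..z} \<subseteq> (f ^^ n) ` ?R" using n by auto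
    moreover have "{a..b} \<subseteq> {z..b} \<union> {a..z}" by auto
    ultimately show "{a..b} \<subseteq> (f ^^ n) ` ?R" by blast
  qed
qed

text \<open>If the images of \<open>{u..v}\<close> avoid \<open>z\<close>, each lies on one side of \<open>z\<close>, and a return of
  \<open>{u..v}\<close> to itself at time \<open>n\<close> makes the sides periodic mod \<open>n\<close>. But near \<open>z\<close> there is
  an interval that changes sides after a multiple of \<open>n\<close> steps.\<close>

lemma reaches_fixed_point:
  assumes z: "f z = z" "0 < z" "z < 1" and c: "z < c" "c < 1" "f c > z"
    and uv: "0 \<le> u" "u < v" "v \<le> 1"
  shows "\<exists>m. z \<in> (f ^^ m) ` {u..v}"
proof (rule ccontr)
  assume neg: "\<not> ?thesis"
  have side: "(f ^^ m) x > z \<longleftrightarrow> (f ^^ m) y > z" if "x \<in> {u..v}" "y \<in> {u..v}" for m x y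
  proof (rule ccontr)
    assume "\<not> ?thesis"
    then have "z \<in> {(f ^^ m) x..(f ^^ m) y} \<or> z \<in> {(f ^^ m) y..(f ^^ m) x}" by auto
    then have "z \<in> (f ^^ m) ` {u..v}"
      using funpow_image_contains_interval[OF f uv(1,3), of "(f ^^ m) x" m "(f ^^ m) y"]
        funpow_image_contains_interval[OF f uv(1,3), of "(f ^^ m) y" m "(f ^^ m) x"] that by blast
    then show False using neg by blast
  qed
  obtain n x0 where n: "n \<ge> 1" "x0 \<in> {u<..<v}" "(f ^^ n) x0 \<in> {u<..<v}"
    using meets_late[of u v u v 1] uv by auto
  have per: "(f ^^ (m + k * n)) x > z \<longleftrightarrow> (f ^^ m) x > z" if x: "x \<in> {u..v}" for m k x
  proof (induction k)
    case (Suc k)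
    have "(f ^^ (m + Suc k * n)) x > z \<longleftrightarrow> (f ^^ (m + k * n + n)) x0 > z"
      using side[OF x, of x0 "m + k * n + n"] n by (simp add: algebra_simps)
    also have "\<dots> \<longleftrightarrow> (f ^^ (m + k * n)) ((f ^^ n) x0) > z" by (subst funpow_add) simp
    also have "\<dots> \<longleftrightarrow> (f ^^ (m + k * n)) x > z" using side[OF _ x, of "(f ^^ n) x0"] n by auto
    finally show ?case using Suc by simp
  qed simp
  obtain N where N: "\<And>m. m \<ge> N \<Longrightarrow> {z/2..z} \<subseteq> (f ^^ m) ` {z..c}"
    using right_germ_eventually_covers[OF z c, of "z/2" z] z by auto
  \<comment> \<open>The time \<open>N * n\<close> is both late enough for the covering and a
    multiple of the period \<open>n\<close>.\<close>
  have "N \<le> N * n" using n by simp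
  then have "z / 2 \<in> (f ^^ (N * n)) ` {z..c}" by (intro subsetD[OF N]) (use z in auto)
  then obtain y where y: "y \<in> {z..c}" "(f ^^ (N * n)) y = z / 2" by auto
  then have "y \<noteq> z" using funpow_fixed[OF z(1)] z by auto
  \<comment> \<open>Points right of \<open>z\<close> that are left of it \<open>N * n\<close> steps
    later: an orbit from \<open>{u<..<v}\<close> entering \<open>V\<close> contradicts
    \<open>per\<close>.\<close>
  define V where "V = {z<..<1} \<inter> preI f (N * n) (unitI \<inter> {..<z})"
  have "openI V" unfolding V_def
    using z by (intro openI_Int openI_preI[OF f] openI_open_interval openI_inter_open) auto
  moreover have "y \<in> V" unfolding V_def preI_def unitI_def using y \<open>y \<noteq> z\<close> z c by auto
  ultimately obtain m where "(f ^^ m) ` {u<..<v} \<inter> V \<noteq> {}"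
    using transitive[of "{u<..<v}" V] openI_open_interval[of u v] uv by force
  then obtain x where x: "x \<in> {u..v}" "(f ^^ m) x \<in> V" by force
  have "(f ^^ (m + N * n)) x = (f ^^ (N * n)) ((f ^^ m) x)"
    by (subst add.commute) (simp add: funpow_add)
  then show False using per[OF x(1), of m N] x(2) unfolding V_def preI_def by auto
qed

text \<open>Some image of \<open>{u..v}\<close> is a nondegenerate interval containing
  \<open>z\<close>. It covers \<open>{z..c}\<close> later on, and \<open>{z..c}\<close> eventually
  covers \<open>{a..b}\<close>.\<close>

lemma eventually_covers:
  assumes z: "f z = z" "0 < z" "z < 1" and c: "z < c" "c < 1" "f c > z"
    and uv: "0 \<le> u" "u < v" "v \<le> 1" and ab: "0 < a" "b < 1"
  shows "\<exists>N. \<forall>n\<ge>N. {a..b} \<subseteq> (f ^^ n) ` {u..v}"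
proof -
  obtain m where m: "z \<in> (f ^^ m) ` {u..v}" using reaches_fixed_point[OF z c uv] by blast
  \<comment> \<open>An orbit off \<open>z\<close> at a time \<open>n \<ge> m\<close> was off
    \<open>z\<close> at time \<open>m\<close>, because \<open>z\<close> is fixed; this makes the
    image nondegenerate.\<close>
  obtain n x where x: "n \<ge> m" "x \<in> {u<..<v}" "(f ^^ n) x \<in> {z<..<1}"
    using meets_late[of u v z 1 m] uv z by auto
  have ne: "(f ^^ m) x \<noteq> z"
  proof
    assume "(f ^^ m) x = z"
    then have "(f ^^ ((n - m) + m)) x = z" using funpow_fixed[OF z(1)] by (simp only: funpow_add o_apply)
    then show False using x by auto
  qed
  define w where "w = (f ^^ m) x"
  have w: "w \<in> unitI" unfolding w_def using x uv by (intro funpow_in_unitI[OF f]) (auto simp: unitI_def)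
  have J: "{min z w..max z w} \<subseteq> (f ^^ m) ` {u..v}"
  proof -
    have "w \<in> (f ^^ m) ` {u..v}" unfolding w_def using x by auto
    then show ?thesis using m
      by (intro funpow_image_contains_interval[OF f]) (use uv in \<open>auto simp: min_def max_def\<close>)
  qed
  obtain k where k: "{z..c} \<subseteq> (f ^^ k) ` {min z w..max z w}"
    using germ_covers_right[OF z, of "min z w" "max z w" c] w ne z c
    unfolding w_def[symmetric] by (auto simp: unitI_def min_less_iff_disj less_max_iff_disj neq_iff)
  obtain N where N: "\<And>n. n \<ge> N \<Longrightarrow> {a..b} \<subseteq> (f ^^ n) ` {z..c}"
    using right_germ_eventually_covers[OF z c ab] by auto
  show ?thesis
  proof (intro exI allI impI)
    fix n assume n: "m + k + N \<le> n"
    have "{a..b} \<subseteq> (f ^^ (m + k + (n - (m + k)))) ` {u..v}"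
      using n by (intro funpow_image_trans[OF funpow_image_trans[OF J k] N]) auto
    then show "{a..b} \<subseteq> (f ^^ n) ` {u..v}" using n by simp
  qed
qed

lemma strongly_mixing_right:
  assumes z: "f z = z" "0 < z" "z < 1" and c: "z < c" "c < 1" "f c > z"
  shows "strongly_mixing f"
  unfolding strongly_mixing_def
proof (intro allI impI, elim conjE)
  fix U V assume UV: "openI U" "U \<noteq> {}" "openI V" "V \<noteq> {}"
  obtain u v where u: "0 < u" "u < v" "v < 1" "{u..v} \<subseteq> U"
    using openI_contains_interval UV by metis
  obtain a b where a: "0 < a" "a < b" "b < 1" "{a..b} \<subseteq> V"
    using openI_contains_interval UV by metis
  obtain N where N: "\<And>n. n \<ge> N \<Longrightarrow> {a..b} \<subseteq> (f ^^ n) ` {u..v}"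
    using eventually_covers[OF z c, of u v a b] u a by auto
  show "\<exists>N. \<forall>n\<ge>N. (f ^^ n) ` U \<inter> V \<noteq> {}"
  proof (intro exI allI impI)
    fix n assume "N \<le> n"
    then have "a \<in> (f ^^ n) ` {u..v}" using N a by force
    then show "(f ^^ n) ` U \<inter> V \<noteq> {}" using u a by force
  qed
qed

end

section \<open>Reflection of the interval and conclusion\<close>

lemma funpow_conj_reflection:
  fixes f :: "real \<Rightarrow> real"
  shows "((\<lambda>x. 1 - f (1 - x)) ^^ n) x = 1 - (f ^^ n) (1 - x)"
  by (induction n) auto

lemma openI_reflection:
  assumes "openI U"
  shows "openI ((\<lambda>x. 1 - x) ` U)"
proof -
  obtain T where T: "open T" "U = unitI \<inter> T"
    using assms unfolding openI_def openin_open by auto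
  have "(\<lambda>x. 1 - x) ` U = unitI \<inter> (\<lambda>x. 1 - x) -` T"
  proof
    show "unitI \<inter> (\<lambda>x. 1 - x) -` T \<subseteq> (\<lambda>x. 1 - x) ` U"
    proof
      fix x assume "x \<in> unitI \<inter> (\<lambda>x. 1 - x) -` T"
      then have "1 - x \<in> U" using T by (auto simp: unitI_def)
      then show "x \<in> (\<lambda>x. 1 - x) ` U" by (intro image_eqI[of _ _ "1 - x"]) auto
    qed
  qed (use T in \<open>auto simp: unitI_def\<close>)
  moreover have "open ((\<lambda>x::real. 1 - x) -` T)"
    using T by (intro open_vimage continuous_intros)
  ultimately show ?thesis using openI_inter_open by simp
qed

lemma interval_map_reflection:
  assumes "interval_map f"
  shows "interval_map (\<lambda>x. 1 - f (1 - x))"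
proof -
  have "continuous_on unitI (\<lambda>x. 1 - f (1 - x))"
    using assms unfolding interval_map_def unitI_def
    by (auto intro!: continuous_intros continuous_on_compose2[of "{0..1}" f _ "\<lambda>x. 1 - x"])
  moreover have "1 - f (1 - x) \<in> unitI" if "x \<in> unitI" for x
    using funpow_in_unitI[OF assms, of "1 - x" 1] that by (auto simp: unitI_def)
  ultimately show ?thesis unfolding interval_map_def by blast
qed

lemma reflection_meets_iff:
  fixes f :: "real \<Rightarrow> real"
  shows "((\<lambda>x. 1 - f (1 - x)) ^^ n) ` U \<inter> V \<noteq> {} \<longleftrightarrow>
     (f ^^ n) ` (\<lambda>x. 1 - x) ` U \<inter> (\<lambda>x. 1 - x) ` V \<noteq> {}"
proof -
  have "1 - (f ^^ n) (1 - x) \<in> V \<longleftrightarrow> (f ^^ n) (1 - x) \<in> (\<lambda>x. 1 - x) ` V" for x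
    by (auto intro!: image_eqI[of _ _ "1 - (f ^^ n) (1 - x)"])
  then show ?thesis unfolding disjoint_iff ball_simps image_image funpow_conj_reflection by auto
qed

lemma transitive_interval_map_reflection:
  assumes "transitive_interval_map f"
  shows "transitive_interval_map (\<lambda>x. 1 - f (1 - x))"
proof
  interpret transitive_interval_map f by (rule assms)
  show "interval_map (\<lambda>x. 1 - f (1 - x))" using interval_map_reflection[OF f] .
  show "\<exists>n. ((\<lambda>x. 1 - f (1 - x)) ^^ n) ` U \<inter> V \<noteq> {}"
    if "openI U" "U \<noteq> {}" "openI V" "V \<noteq> {}" for U V
    unfolding reflection_meets_iff using that by (intro transitive openI_reflection) auto
qed

lemma strongly_mixing_reflection:
  assumes "strongly_mixing (\<lambda>x. 1 - f (1 - x))"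
  shows "strongly_mixing f"
  unfolding strongly_mixing_def
proof (intro allI impI, elim conjE)
  fix U V assume UV: "openI U" "U \<noteq> {}" "openI V" "V \<noteq> {}"
  let ?r = "\<lambda>x::real. 1 - x"
  have rr: "?r ` ?r ` A = A" for A by (simp add: image_comp)
  have "openI (?r ` U)" "?r ` U \<noteq> {}" "openI (?r ` V)" "?r ` V \<noteq> {}"
    using UV openI_reflection by auto
  then have "\<exists>N. \<forall>n\<ge>N. ((\<lambda>x. 1 - f (1 - x)) ^^ n) ` ?r ` U \<inter> ?r ` V \<noteq> {}"
    using assms unfolding strongly_mixing_def by meson
  then show "\<exists>N. \<forall>n\<ge>N. (f ^^ n) ` U \<inter> V \<noteq> {}"
    unfolding reflection_meets_iff rr .
qed

text \<open>At an interior fixed point \<open>z\<close>, a point right of \<open>z\<close> mapped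
  further right of \<open>z\<close> than \<open>z\<close> itself would give mixing. The reflected
  map excludes the mirror case, and continuity settles the end points.\<close>

lemma transitive_not_mixing_imp_swap:
  assumes "transitive_interval_map f" and nmix: "\<not> strongly_mixing f"
  obtains z where "0 < z" "z < 1"
    "\<And>x. x \<in> {0..z} \<Longrightarrow> f x \<in> {z..1}" "\<And>x. x \<in> {z..1} \<Longrightarrow> f x \<in> {0..z}"
proof -
  interpret transitive_interval_map f by (rule assms)
  obtain z where z: "f z = z" "0 < z" "z < 1" using interior_fixed_point by auto
  have right: "f x \<le> z" if "z < x" "x < 1" for x
    using strongly_mixing_right[OF z that] nmix by force
  have left: "z \<le> f x" if "0 < x" "x < z" for x
  proof (rule ccontr)
    assume "\<not> z \<le> f x"
    moreover interpret g: transitive_interval_map "\<lambda>x. 1 - f (1 - x)"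
      by (rule transitive_interval_map_reflection[OF assms(1)])
    \<comment> \<open>The reflection fixes \<open>1 - z\<close> and sends \<open>1 - x\<close>, to
      the right of it, to \<open>1 - f x\<close>, again to the right.\<close>
    have "strongly_mixing (\<lambda>x. 1 - f (1 - x))"
      using g.strongly_mixing_right[of "1 - z" "1 - x"] z that \<open>\<not> z \<le> f x\<close> by auto
    then show False using strongly_mixing_reflection nmix by blast
  qed
  have cont: "continuous_on {0..1} f" and rng: "\<And>x. x \<in> {0..1} \<Longrightarrow> f x \<in> {0..1}"
    using f funpow_in_unitI[OF f, of _ 1] unfolding interval_map_def unitI_def by auto
  have R: "f x \<in> {0..z}" if x: "x \<in> {z..1}" for x
  proof -
    have cl: "closure {z<..<1} = {z..1}" using z by simp
    have "f x \<le> z"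
      using continuous_le_on_closure[of "{z<..<1}" f x z] continuous_on_subset[OF cont, of "{z..1}"]
        right x z unfolding cl by auto
    then show ?thesis using rng[of x] x z by auto
  qed
  have L: "f x \<in> {z..1}" if x: "x \<in> {0..z}" for x
  proof -
    have cl: "closure {0<..<z} = {0..z}" using z by simp
    have "f x \<ge> z"
      using continuous_ge_on_closure[of "{0<..<z}" f x z] continuous_on_subset[OF cont, of "{0..z}"]
        left x z unfolding cl by auto
    then show ?thesis using rng[of x] x z by auto
  qed
  show ?thesis using that[of z] z L R by blast
qed

lemma nondense_covers_complex_imp_strongly_mixing:
  assumes f: "interval_map f" and cc: "nondense_covers_complex f"
  shows "strongly_mixing f"
proof (rule ccontr)
  assume nmix: "\<not> strongly_mixing f"
  have "transitive_interval_map f"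
    by standard (use f nondense_covers_complex_imp_transitive[OF f cc] in blast)+
  then obtain z where "0 < z" "z < 1"
    "\<And>x. x \<in> {0..z} \<Longrightarrow> f x \<in> {z..1}" "\<And>x. x \<in> {z..1} \<Longrightarrow> f x \<in> {0..z}"
    using transitive_not_mixing_imp_swap nmix by metis
  then show False using nondense_covers_complex_imp_no_swap[OF f cc] by metis
qed

theorem mainTheorem18:
  fixes f :: "real \<Rightarrow> real"
  assumes "interval_map f"
  shows "(strongly_mixing f \<longleftrightarrow>
            (\<forall>U1 U2. openI U1 \<and> openI U2 \<and> U1 \<union> U2 = unitI \<and>
                closure U1 \<noteq> unitI \<and> closure U2 \<noteq> unitI \<longrightarrow> complexity f {U1, U2} > 2))
       \<and> (strongly_mixing f \<longleftrightarrow> uniformly_positive_entropy f)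
       \<and> (strongly_mixing f \<longleftrightarrow> topological_K f)"
  unfolding nondense_covers_complex_def[symmetric]
  \<comment> \<open>The four implications form a cycle.\<close>
  using assms strongly_mixing_imp_topological_K topological_K_imp_upe
    upe_imp_nondense_covers_complex nondense_covers_complex_imp_strongly_mixing
  by blast

end
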